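(* $\mathfrak{s} = \mathfrak{s}_{\omega,\omega}$.
   Context: $\mathcal{P}(\omega)$ is the power set of $\omega$ and $[\omega]^{\omega}$ is the set of infinite subsets of $\omega$. For $x \subset \omega$, write $x^0 = x$ and $x^1 = \omega \setminus x$. For $x, a \in \mathcal{P}(\omega)$, $x$ splits $a$ if $|x^0 \cap a| = |x^1 \cap a| = \omega$. A family $\mathcal{F} \subset \mathcal{P}(\omega)$ is a splitting family if for every $a \in [\omega]^{\omega}$ there is $x \in \mathcal{F}$ such that $x$ splits $a$. A family $\mathcal{F} \subset \mathcal{P}(\omega)$ is $(\omega,\omega)$-splitting if for each countable collection $\{a_n : n \in \omega\} \subset [\omega]^{\omega}$ there exists $x \in \mathcal{F}$ such that there are infinitely many $n \in \omega$ with $|x^0 \cap a_n| = \omega$ and there are infinitely many $n \in \omega$ with $|x^1 \cap a_n| = \omega$. Define $$\mathfrak{s} = \min\{|\mathcal{F}| : \mathcal{F} \subset \mathcal{P}(\omega) \text{ is a splitting family}\},$$ $$\mathfrak{s}_{\omega,\omega} = \min\{|\mathcal{F}| : \mathcal{F} \subset \mathcal{P}(\omega) \text{ is } (\omega,\omega)\text{-splitting}\}.$$ The ambient theory is ZFC. *)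

theory Defs
  imports "HOL-Library.Nat_Bijection" "HOL-Library.Infinite_Set"
begin

unbundle cardinal_syntax

definition splits :: "nat set \<Rightarrow> nat set \<Rightarrow> bool" where
  "splits x a \<longleftrightarrow> infinite (x \<inter> a) \<and> infinite ((UNIV - x) \<inter> a)"

definition splitting_family :: "nat set set \<Rightarrow> bool" where
  "splitting_family F \<longleftrightarrow> (\<forall>a. infinite a \<longrightarrow> (\<exists>x\<in>F. splits x a))"

definition omega_omega_splitting :: "nat set set \<Rightarrow> bool" where
  "omega_omega_splitting F \<longleftrightarrow>
     (\<forall>a :: nat \<Rightarrow> nat set. (\<forall>n. infinite (a n)) \<longrightarrow>
        (\<exists>x\<in>F. infinite {n. infinite (x \<inter> a n)} \<and>
               infinite {n. infinite ((UNIV - x) \<inter> a n)}))"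

text \<open>
  A cardinal is represented, as in the library, by a cardinal well-order; cardinals are
  compared up to isomorphism by \<open>\<le>o\<close> and \<open>=o\<close>. The least cardinality of a set with property
  \<open>P\<close> is represented by \<open>|A|\<close> for any \<open>A\<close> of least cardinality among the sets satisfying \<open>P\<close>.
  It is meaningful only if some set satisfies \<open>P\<close>.
\<close>

definition min_card :: "('a set \<Rightarrow> bool) \<Rightarrow> 'a rel" where
  "min_card P = |SOME A. P A \<and> (\<forall>B. P B \<longrightarrow> |A| \<le>o |B| )|"

lemma min_card_attained:
  assumes "P C"
  shows "\<exists>A. P A \<and> min_card P = |A|" and "\<And>B. P B \<Longrightarrow> min_card P \<le>o |B|"
proof -
  have "\<exists>r \<in> card_of ` Collect P. \<forall>r' \<in> card_of ` Collect P. r \<le>o r'"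
    using assms by (intro exists_minim_Well_order) (auto simp: card_of_Well_order simp del: Field_card_of)
  then have "\<exists>A. P A \<and> (\<forall>B. P B \<longrightarrow> |A| \<le>o |B| )"
    by auto
  from someI_ex[OF this] show "\<exists>A. P A \<and> min_card P = |A|" and "\<And>B. P B \<Longrightarrow> min_card P \<le>o |B|"
    unfolding min_card_def by blast+
qed

definition splitting_number :: "nat set rel" where
  "splitting_number = min_card splitting_family"

definition omega_omega_splitting_number :: "nat set rel" where
  "omega_omega_splitting_number = min_card omega_omega_splitting"

text \<open>Both minima are taken over nonempty collections, since \<open>UNIV\<close> has either property.\<close>

lemma exists_simultaneous_splitter:
  fixes a :: "nat \<Rightarrow> nat set"
  assumes "\<And>n. infinite (a n)"
  shows "\<exists>x. \<forall>n. splits x (a n)"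
proof -
  have "\<exists>m. m \<in> a n \<and> l < m" for n l
    using assms[of n] by (metis infinite_nat_iff_unbounded)
  then have "\<exists>f. \<forall>k. f k \<in> a (fst (prod_decode k)) \<and> f k < f (Suc k)"
    by (intro dependent_nat_choice) blast+
  then obtain f where f: "\<And>k. f k \<in> a (fst (prod_decode k))" "\<And>k. f k < f (Suc k)"
    by blast
  have "inj f"
    using f(2) by (simp add: strict_mono_Suc_iff strict_mono_imp_inj_on)
  then have inj_g: "inj (\<lambda>k. f (prod_encode (n, h k)))" if "inj h" for h :: "nat \<Rightarrow> nat" and n :: nat
    using that by (intro injI) (simp add: inj_eq)
  define x where "x = {f (prod_encode (n, 2 * k)) | n k. True}"
  have "splits x (a n)" for n
  proof -
    have "range (\<lambda>k. f (prod_encode (n, 2 * k))) \<subseteq> x \<inter> a n"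
      using f(1)[of "prod_encode (n, _)"] by (auto simp: x_def)
    moreover have "f (prod_encode (n, Suc (2 * k))) \<notin> x" for k
    proof
      assume "f (prod_encode (n, Suc (2 * k))) \<in> x"
      then obtain k' where "Suc (2 * k) = 2 * k'"
        using \<open>inj f\<close> by (auto simp: x_def inj_eq)
      then show False by presburger
    qed
    then have "range (\<lambda>k. f (prod_encode (n, Suc (2 * k)))) \<subseteq> (UNIV - x) \<inter> a n"
      using f(1)[of "prod_encode (n, _)"] by auto
    moreover have "infinite (range (\<lambda>k. f (prod_encode (n, 2 * k))))"
      "infinite (range (\<lambda>k. f (prod_encode (n, Suc (2 * k)))))"
      by (rule range_inj_infinite, rule inj_g, simp add: inj_on_def)+
    ultimately show ?thesis
      unfolding splits_def using infinite_super by blast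
  qed
  then show ?thesis by blast
qed

lemma splitting_family_UNIV: "splitting_family UNIV"
  unfolding splitting_family_def 
proof (intro allI impI)
  fix a :: "nat set"
  assume "infinite a"
  then show "\<exists>x\<in>UNIV. splits x a"
    using exists_simultaneous_splitter[of "\<lambda>_. a"] by simp
qed

lemma omega_omega_splitting_UNIV: "omega_omega_splitting UNIV"
  unfolding omega_omega_splitting_def
proof (intro allI impI)
  fix a :: "nat \<Rightarrow> nat set"
  assume "\<forall>n. infinite (a n)"
  then obtain x where "\<And>n. splits x (a n)"
    using exists_simultaneous_splitter[of a] by blast
  then show "\<exists>x\<in>UNIV. infinite {n. infinite (x \<inter> a n)} \<and>
      infinite {n. infinite ((UNIV - x) \<inter> a n)}"
    by (intro bexI[of _ x]) (simp_all add: splits_def)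
qed

end

theory Submission
  imports Defs
begin

text \<open>
  Let \<open>F\<close> be a splitting family. If \<open>F\<close> fails to be \<open>(\<omega>,\<omega>)\<close>-splitting at \<open>(a\<^sub>n)\<close>, then every
  \<open>x \<in> F\<close> has a side whose trace on \<open>a\<^sub>n\<close> is finite for almost all \<open>n\<close>; let \<open>h x n\<close> bound that
  trace. No \<open>g\<close> dominates all \<open>h x\<close>, since points \<open>m\<^sub>n \<in> a\<^sub>n\<close> above \<open>g n\<close> would form
  an infinite set that \<open>F\<close> does not split. Hence \<open>F\<close> is infinite and carries an unbounded family of
  functions of size at most \<open>|F|\<close>. Each \<open>h x\<close> yields an interval partition, and an unbounded
  family yields, for any sequence of infinite sets \<open>b\<^sub>i\<close>, a partition in which infinitely many of
  the intervals \<open>I\<^sub>k\<close> meet all \<open>b\<^sub>i\<close> with \<open>i \<le> k\<close>. If \<open>y \<in> F\<close> splits the set of these \<open>k\<close>, the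
  union of the \<open>I\<^sub>k\<close> with \<open>k \<in> y\<close> splits every \<open>b\<^sub>i\<close>. There are at most \<open>|F \<times> F| = |F|\<close> such unions.
\<close>

section \<open>Unbounded families of functions from splitting families\<close>

definition unbounded_family :: "(nat \<Rightarrow> nat) set \<Rightarrow> bool" where
  "unbounded_family B \<longleftrightarrow> (\<forall>g. \<exists>f\<in>B. \<exists>\<^sub>\<infinity>n. g n < f n)"

text \<open>The pointwise sum of a finite family dominates each of its members.\<close>

lemma unbounded_family_infinite:
  assumes "unbounded_family B"
  shows "infinite B"
proof
  assume fin: "finite B"
  obtain f where f: "f \<in> B" "\<exists>\<^sub>\<infinity>n. (\<Sum>f\<in>B. f n) < f n"
    using assms[unfolded unbounded_family_def, THEN spec, of "\<lambda>n. \<Sum>f\<in>B. f n"] by blast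
  have "f n \<le> (\<Sum>f\<in>B. f n)" for n
    using fin f(1) by (intro member_le_sum) auto
  then have "\<not> (\<Sum>f\<in>B. f n) < f n" for n
    by (simp add: not_less)
  with f(2) show False
    by simp
qed

lemma unbounded_family_of_not_omega_omega_splitting:
  assumes F: "splitting_family F" and nF: "\<not> omega_omega_splitting F"
  shows "\<exists>h. unbounded_family (h ` F)"
proof -
  obtain a :: "nat \<Rightarrow> nat set" where a: "\<And>n. infinite (a n)"
    and ns: "\<And>x. x \<in> F \<Longrightarrow> finite {n. infinite (x \<inter> a n)} \<or> finite {n. infinite ((UNIV - x) \<inter> a n)}"
    using nF unfolding omega_omega_splitting_def by blast
  then have "\<forall>x\<in>F. \<exists>c\<in>{x, UNIV - x}. finite {n. infinite (c \<inter> a n)}"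
    by blast
  then obtain c where c: "\<And>x. x \<in> F \<Longrightarrow> c x \<in> {x, UNIV - x}"
    and fin: "\<And>x. x \<in> F \<Longrightarrow> finite {n. infinite (c x \<inter> a n)}"
    by metis
  \<comment> \<open>The value is arbitrary where the trace is infinite; those finitely many
    \<open>n\<close> are set apart as exceptions below.\<close>
  define h where "h x n = Suc (Max (c x \<inter> a n))" for x n
  have "\<exists>x\<in>F. \<exists>\<^sub>\<infinity>n. g n < h x n" for g
  proof (rule ccontr)
    assume "\<not> ?thesis"
    then have dom: "finite {n. g n < h x n}" if "x \<in> F" for x
      using that by (auto simp: INFM_iff_infinite)
    have "\<exists>m. m \<in> a n \<and> max n (g n) < m" for n
      using a[of n] by (metis infinite_nat_iff_unbounded)
    then obtain m where m: "\<And>n. m n \<in> a n" "\<And>n. n < m n" "\<And>n. g n < m n"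
      by (metis max_less_iff_conj)
    have "infinite (range m)"
      unfolding infinite_nat_iff_unbounded using m(2) by blast
    then obtain x where x: "x \<in> F" "splits x (range m)"
      using F unfolding splitting_family_def by blast
    have "c x \<inter> range m \<subseteq> m ` ({n. infinite (c x \<inter> a n)} \<union> {n. g n < h x n})"
    proof (clarify, rule imageI, rule ccontr)
      fix n assume "m n \<in> c x"
        and n: "n \<notin> {n. infinite (c x \<inter> a n)} \<union> {n. g n < h x n}"
      then have "m n \<le> Max (c x \<inter> a n)"
        using m(1) by (intro Max_ge) auto
      with n m(3)[of n] show False
        by (simp add: h_def)
    qed
    then have "finite (c x \<inter> range m)"
      using fin[OF x(1)] dom[OF x(1)] by (meson finite_UnI finite_imageI finite_subset)
    with c[OF x(1)] x(2) show False
      unfolding splits_def by auto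
  qed
  then have "unbounded_family (h ` F)"
    by (simp add: unbounded_family_def)
  then show ?thesis
    by blast
qed

section \<open>Interval partitions induced by functions\<close>

text \<open>The sum gives monotonicity for arbitrary \<open>f\<close>; the summand
  \<open>Suc n\<close> makes the iterates increase strictly.\<close>

definition majorant :: "(nat \<Rightarrow> nat) \<Rightarrow> nat \<Rightarrow> nat" where
  "majorant f n = Suc n + (\<Sum>i\<le>n. f i)"

lemma mono_sum_atMost: "mono (\<lambda>n. \<Sum>i\<le>n. f i)" for f :: "nat \<Rightarrow> nat"
  by (intro monoI sum_mono2) auto

lemma majorant_mono: "mono (majorant f)"
  using mono_sum_atMost[of f] unfolding majorant_def mono_def by (meson Suc_le_mono add_mono)

lemma majorant_ge: "f n \<le> majorant f n"
  unfolding majorant_def using member_le_sum[of n "{..n}" f] by simp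

definition endpoint :: "(nat \<Rightarrow> nat) \<Rightarrow> nat \<Rightarrow> nat" where
  "endpoint f k = (majorant f ^^ k) 0"

lemma endpoint_Suc: "endpoint f (Suc k) = majorant f (endpoint f k)"
  by (simp add: endpoint_def)

lemma endpoint_strict_mono: "strict_mono (endpoint f)"
  by (simp add: strict_mono_Suc_iff endpoint_Suc) (simp add: majorant_def)

text \<open>Since \<open>k \<le> endpoint f k\<close>, only finitely many endpoints are at most
  \<open>n\<close>; the largest such index works.\<close>

lemma endpoint_interval:
  "\<exists>k. endpoint f k \<le> n \<and> n < endpoint f (Suc k)"
proof -
  have "endpoint f 0 \<le> n"
    by (simp add: endpoint_def)
  moreover have "\<And>k. endpoint f k \<le> n \<Longrightarrow> k \<le> n"
    using strict_mono_imp_increasing[OF endpoint_strict_mono] le_trans by blast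
  ultimately obtain k where "endpoint f k \<le> n" "\<And>j. endpoint f j \<le> n \<Longrightarrow> j \<le> k"
    using GreatestI_nat[of "\<lambda>k. endpoint f k \<le> n" 0 n] Greatest_le_nat[of "\<lambda>k. endpoint f k \<le> n" _ n]
    by blast
  then show ?thesis
    by (metis Suc_n_not_le_n not_le)
qed

text \<open>
  A point \<open>n \<in> I\<^sub>k\<close> with \<open>f n > g (g n)\<close> only confines \<open>[n, g (g n)]\<close> to \<open>I\<^sub>k \<union> I\<^sub>k\<^sub>+\<^sub>1\<close>; iterating
  \<open>g\<close> twice ensures that one of these two intervals is long by itself.
\<close>

lemma infinitely_many_long_intervals:
  assumes "mono g" and f: "\<exists>\<^sub>\<infinity>n. g (g n) < f n"
  shows "\<exists>\<^sub>\<infinity>k. g (endpoint f k) \<le> endpoint f (Suc k)"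
  unfolding INFM_nat_le
proof
  fix K
  obtain n where n: "endpoint f K \<le> n" "g (g n) < f n"
    using f unfolding INFM_nat_le by blast
  obtain k where k: "endpoint f k \<le> n" "n < endpoint f (Suc k)"
    using endpoint_interval by blast
  have "K \<le> k"
    using n(1) k(2) strict_mono_less[OF endpoint_strict_mono, of f K "Suc k"] by linarith
  show "\<exists>k\<ge>K. g (endpoint f k) \<le> endpoint f (Suc k)"
  proof (cases "g n \<le> endpoint f (Suc k)")
    case True
    then show ?thesis
      using \<open>K \<le> k\<close> monoD[OF \<open>mono g\<close> k(1)] by (intro exI[of _ k]) simp
  next
    case False
    then have "g (endpoint f (Suc k)) \<le> g (g n)"
      by (intro monoD[OF \<open>mono g\<close>]) simp
    also have "\<dots> \<le> majorant f n"
      using n(2) majorant_ge[of f n] by simp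
    also have "\<dots> \<le> endpoint f (Suc (Suc k))"
      unfolding endpoint_Suc[of f "Suc k"] using k(2) by (intro monoD[OF majorant_mono]) simp
    finally show ?thesis
      using \<open>K \<le> k\<close> by (intro exI[of _ "Suc k"]) simp
  qed
qed

section \<open>Unions of intervals as splitting sets\<close>

definition interval_union :: "(nat \<Rightarrow> nat) \<Rightarrow> nat set \<Rightarrow> nat set" where
  "interval_union f y = (\<Union>k\<in>y. {endpoint f k..<endpoint f (Suc k)})"

text \<open>Intervals with different indices are disjoint: a common point gives
  \<open>j < Suc k\<close> and \<open>k < Suc j\<close>.\<close>

lemma interval_union_Compl: "interval_union f (UNIV - y) \<subseteq> UNIV - interval_union f y"
proof -
  have "j = k" if "endpoint f j \<le> m" "m < endpoint f (Suc j)"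
    "endpoint f k \<le> m" "m < endpoint f (Suc k)" for j k m
  proof -
    have "endpoint f j < endpoint f (Suc k)" "endpoint f k < endpoint f (Suc j)"
      using that by linarith+
    then show ?thesis
      by (simp add: strict_mono_less[OF endpoint_strict_mono])
  qed
  then show ?thesis
    unfolding interval_union_def by (auto; blast)
qed

text \<open>Each large \<open>k\<close> in \<open>y \<inter> A\<close> contributes a point of
  \<open>b\<close> that is at least \<open>endpoint f k\<close>, hence at least
  \<open>k\<close>.\<close>

lemma infinite_interval_union_Int:
  assumes "infinite (y \<inter> A)"
    and "\<And>k. k \<in> A \<Longrightarrow> i \<le> k \<Longrightarrow> \<exists>m\<in>b. endpoint f k \<le> m \<and> m < endpoint f (Suc k)"
  shows "infinite (interval_union f y \<inter> b)"
  unfolding infinite_nat_iff_unbounded_le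
proof
  fix l
  obtain k where k: "k \<in> y" "k \<in> A" "max i l \<le> k"
    using assms(1) unfolding infinite_nat_iff_unbounded_le by blast
  then obtain m where "m \<in> b" "endpoint f k \<le> m" "m < endpoint f (Suc k)"
    using assms(2)[of k] by auto
  moreover have "l \<le> endpoint f k"
    using k(3) strict_mono_imp_increasing[OF endpoint_strict_mono, of k f] by linarith
  ultimately show "\<exists>n\<ge>l. n \<in> interval_union f y \<inter> b"
    using k(1) unfolding interval_union_def by (intro exI[of _ m]) auto
qed

lemma interval_union_splits_sequence:
  assumes F: "splitting_family F" and B: "unbounded_family B"
    and b: "\<And>i :: nat. infinite (b i)"
  shows "\<exists>f\<in>B. \<exists>y\<in>F. \<forall>i. splits (interval_union f y) (b i)"
proof -
  have "\<exists>m. m \<in> b i \<and> n \<le> m" for i n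
    using b[of i] by (metis infinite_nat_iff_unbounded_le)
  then obtain r where r: "\<And>i n. r i n \<in> b i" "\<And>i n. n \<le> r i n"
    by metis
  \<comment> \<open>The inner sum bounds \<open>r i j\<close> for all \<open>i \<le> j\<close> at
    once, \<open>Suc\<close> makes the bound strict because the intervals are right-open, and the
    outer sum makes \<open>g\<close> monotone.\<close>
  define g where "g = (\<lambda>n. \<Sum>j\<le>n. Suc (\<Sum>i\<le>j. r i j))"
  have "mono g"
    unfolding g_def by (rule mono_sum_atMost)
  have g: "r i n < g n" if "i \<le> n" for i n
  proof -
    have "r i n \<le> (\<Sum>i\<le>n. r i n)"
      using that by (intro member_le_sum) auto
    also have "\<dots> < g n"
      unfolding g_def using member_le_sum[of n "{..n}" "\<lambda>j. Suc (\<Sum>i\<le>j. r i j)"] by simp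
    finally show ?thesis .
  qed
  obtain f where f: "f \<in> B" "\<exists>\<^sub>\<infinity>n. g (g n) < f n"
    using B[unfolded unbounded_family_def, THEN spec, of "\<lambda>n. g (g n)"] by blast
  define A where "A = {k. g (endpoint f k) \<le> endpoint f (Suc k)}"
  have "infinite A"
    using infinitely_many_long_intervals[OF \<open>mono g\<close> f(2)] by (simp add: A_def INFM_iff_infinite)
  then obtain y where y: "y \<in> F" "splits y A"
    using F unfolding splitting_family_def by blast
  have meets: "\<exists>m\<in>b i. endpoint f k \<le> m \<and> m < endpoint f (Suc k)" if "k \<in> A" "i \<le> k" for i k
  proof (intro bexI conjI)
    have "i \<le> endpoint f k"
      using that(2) strict_mono_imp_increasing[OF endpoint_strict_mono, of k f] by linarith
    then show "r i (endpoint f k) < endpoint f (Suc k)"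
      using g[of i "endpoint f k"] that(1) by (simp add: A_def)
  qed (use r in auto)
  have "splits (interval_union f y) (b i)" for i
    unfolding splits_def
  proof
    show "infinite (interval_union f y \<inter> b i)"
      using y(2) meets unfolding splits_def by (intro infinite_interval_union_Int) auto
    have "infinite (interval_union f (UNIV - y) \<inter> b i)"
      using y(2) meets unfolding splits_def by (intro infinite_interval_union_Int) auto
    then show "infinite ((UNIV - interval_union f y) \<inter> b i)"
      by (rule infinite_super[rotated]) (intro Int_mono interval_union_Compl order_refl)
  qed
  with f(1) y(1) show ?thesis
    by blast
qed

section \<open>Comparison of the two cardinals\<close>

lemma splitting_imp_omega_omega_splitting_card:
  assumes F: "splitting_family F"
  shows "\<exists>G. omega_omega_splitting G \<and> |G| \<le>o |F|"
proof (cases "omega_omega_splitting F")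
  case True
  then show ?thesis
    using ordLeq_refl[OF card_of_Card_order] by blast
next
  case False
  then obtain h where h: "unbounded_family (h ` F)"
    using unbounded_family_of_not_omega_omega_splitting[OF F] by blast
  then have "infinite F"
    using unbounded_family_infinite by blast
  define G where "G = (\<lambda>(x, y). interval_union (h x) y) ` (F \<times> F)"
  have "omega_omega_splitting G"
    unfolding omega_omega_splitting_def
  proof (intro allI impI)
    fix a :: "nat \<Rightarrow> nat set"
    assume "\<forall>n. infinite (a n)"
    then obtain x y where "x \<in> F" "y \<in> F" and s: "\<forall>i. splits (interval_union (h x) y) (a i)"
      using interval_union_splits_sequence[OF F h] by blast
    then have "interval_union (h x) y \<in> G"
      unfolding G_def by blast
    with s show "\<exists>x\<in>G. infinite {n. infinite (x \<inter> a n)} \<and> infinite {n. infinite ((UNIV - x) \<inter> a n)}"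
      by (intro bexI[of _ "interval_union (h x) y"]) (simp_all add: splits_def)
  qed
  moreover have "|G| \<le>o |F|"
    unfolding G_def using card_of_image card_of_Times_same_infinite[OF \<open>infinite F\<close>]
    by (rule ordLeq_ordIso_trans)
  ultimately show ?thesis
    by blast
qed

text \<open>Constant sequences suffice: an infinite set of indices is nonempty, so both sides of
  \<open>x\<close> have infinite trace.\<close>

lemma omega_omega_splitting_imp_splitting:
  assumes "omega_omega_splitting F"
  shows "splitting_family F"
  unfolding splitting_family_def
proof (intro allI impI)
  fix a :: "nat set"
  assume "infinite a"
  then obtain x where x: "x \<in> F" "infinite {n :: nat. infinite (x \<inter> a)}"
    "infinite {n :: nat. infinite ((UNIV - x) \<inter> a)}"
    using assms[unfolded omega_omega_splitting_def, rule_format, of "\<lambda>_. a"] by blast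
  then have "splits x a"
    unfolding splits_def by (metis (mono_tags, lifting) Collect_empty_eq finite.emptyI)
  with x(1) show "\<exists>x\<in>F. splits x a"
    by blast
qed

theorem theorem6: "splitting_number =o omega_omega_splitting_number"
proof -
  obtain F where F: "splitting_family F" "splitting_number = |F|"
    using min_card_attained(1)[of splitting_family, OF splitting_family_UNIV]
    unfolding splitting_number_def by blast
  obtain G where G: "omega_omega_splitting G" "omega_omega_splitting_number = |G|"
    using min_card_attained(1)[of omega_omega_splitting, OF omega_omega_splitting_UNIV]
    unfolding omega_omega_splitting_number_def by blast
  obtain H where H: "omega_omega_splitting H" "|H| \<le>o |F|"
    using splitting_imp_omega_omega_splitting_card[OF F(1)] by blast
  have "|F| \<le>o |G|"
    using min_card_attained(2)[of splitting_family, OF splitting_family_UNIV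
        omega_omega_splitting_imp_splitting[OF G(1)]] F(2)
    unfolding splitting_number_def by simp
  moreover have "|G| \<le>o |F|"
    using min_card_attained(2)[of omega_omega_splitting, OF omega_omega_splitting_UNIV H(1)] G(2) H(2)
    unfolding omega_omega_splitting_number_def by (metis ordLeq_transitive)
  ultimately show ?thesis
    unfolding F(2) G(2) ordIso_iff_ordLeq by blast
qed

end
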